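(* Let $q<c\le1$ and suppose that the sequence of monic polynomials $\{P_n^{(c)}(x)\}_{n=0}^\infty$ ($\deg P_n^{(c)}=n$) satisfies the orthogonality condition \[ \int_{-\infty}^{\infty}P_n^{(c)}(cx)P_m^{(c)}(cx)w(cx)\,d_qx=\gamma_n^{(c)}\delta_{n,m}. \] Then the recurrence coefficients $\{\alpha_n^{(c)}\}_{n=1}^\infty$ occurring in the recurrence relation \[ xP_n^{(c)}(x)=P_{n+1}^{(c)}(x)+\alpha_n^{(c)}P_{n-1}^{(c)}(x) \] solve the equation \[ \alpha_n\left(\alpha_{n+1}+q^{n-1}\alpha_n+q^{-2}\alpha_{n-1}-q^{2n-3}\alpha_{n+1}\alpha_n\alpha_{n-1}\right)=(q^{-n}-1)q^{1-n}, \] with initial conditions $\alpha_n=0$ for $n\le0$. Furthermore, \[ D_{q^{-1}}P_n^{(c)}=[n]_{q^{-1}}P_{n-1}^{(c)}+\frac{q^{n-3}}{q^{-1}-1}\,\alpha_n^{(c)}\alpha_{n-1}^{(c)}\alpha_{n-2}^{(c)}\,P_{n-3}^{(c)}. \]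
   Context: $q\in\mathbb{R}$, $0<q<1$; $(x;q)_\infty=\prod_{j\ge0}(1-xq^j)$; $w(x)=1/(-x^4;q^4)_\infty$; $\int_{-\infty}^{\infty}f(x)\,d_qx=\sum_{k\in\mathbb{Z}}q^k\big(f(q^k)+f(-q^k)\big)$. $D_{q^{-1}}f(x)=\frac{f(q^{-1}x)-f(x)}{x(q^{-1}-1)}$ and $[n]_{q^{-1}}=\frac{q^{-n}-1}{q^{-1}-1}$. Polynomials with negative index are taken to be $0$. *)

theory Defs
  imports "HOL-Analysis.Analysis" "HOL-Computational_Algebra.Polynomial"
begin

definition qpoch_inf :: "real \<Rightarrow> real \<Rightarrow> real" where
  "qpoch_inf x q = (\<Prod>j. 1 - x * q ^ j)"

definition weight :: "real \<Rightarrow> real \<Rightarrow> real" where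
  "weight q x = 1 / qpoch_inf (- (x ^ 4)) (q ^ 4)"

definition jackson_integral :: "real \<Rightarrow> (real \<Rightarrow> real) \<Rightarrow> real" where
  "jackson_integral q f =
     (\<Sum>\<^sub>\<infinity>k\<in>(UNIV :: int set). q powi k * (f (q powi k) + f (- (q powi k))))"

(* Only meaningful for x \<noteq> 0; at x = 0 division by zero gives the junk value 0. *)
definition Dqinv :: "real \<Rightarrow> (real \<Rightarrow> real) \<Rightarrow> real \<Rightarrow> real" where
  "Dqinv q f x = (f (inverse q * x) - f x) / (x * (inverse q - 1))"

definition qinv_bracket :: "real \<Rightarrow> int \<Rightarrow> real" where
  "qinv_bracket q n = (q powi (- n) - 1) / (inverse q - 1)"

(* Sequences are indexed by int so that P (n - 3), \<alpha> (n - 2) etc. make sense for every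
   n \<ge> 0; entries with negative index are the zero polynomial. *)
definition monic_sequence :: "(int \<Rightarrow> real poly) \<Rightarrow> bool" where
  "monic_sequence P \<longleftrightarrow>
     (\<forall>n\<ge>0. degree (P n) = nat n \<and> lead_coeff (P n) = 1) \<and> (\<forall>n<0. P n = 0)"

definition orthogonal_sequence ::
  "real \<Rightarrow> real \<Rightarrow> (int \<Rightarrow> real poly) \<Rightarrow> (int \<Rightarrow> real) \<Rightarrow> bool" where
  "orthogonal_sequence q c P \<gamma> \<longleftrightarrow>
     (\<forall>n\<ge>0. \<forall>m\<ge>0.
        jackson_integral q (\<lambda>x. poly (P n) (c * x) * poly (P m) (c * x) * weight q (c * x))
          = (if n = m then \<gamma> n else 0))"

definition recurrence_coeffs :: "(int \<Rightarrow> real poly) \<Rightarrow> (int \<Rightarrow> real) \<Rightarrow> bool" where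
  "recurrence_coeffs P \<alpha> \<longleftrightarrow>
     (\<forall>n\<le>0. \<alpha> n = 0) \<and>
     (\<forall>n\<ge>0. [:0, 1:] * P n = P (n + 1) + smult (\<alpha> n) (P (n - 1)))"

end

theory Submission
  imports Defs
begin

text \<open>
  Write \<open>L p\<close> for the Jackson integral of \<open>p(cx) w(cx)\<close>. The Jackson sum runs over all integer powers
  of \<open>q\<close>, so shifting the summation index by one turns the functional equation
  \<open>w(qx) = (1 + x^4) w(x)\<close> into \<open>L(p(x/q)) = q L((1 + x^4) p)\<close>. This identity, the symmetry of \<open>L\<close>
  under \<open>x \<mapsto> -x\<close>, and \<open>L(p^2) \<noteq> 0\<close> for \<open>p \<noteq> 0\<close> are all that is needed of \<open>L\<close>; the parameter
  \<open>c\<close> selects one functional with these properties among many. They are verified in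
  \<open>jackson_functional\<close> and collected in the locale \<open>quartic_functional\<close>, in which everything else
  is algebra.

  Let \<open>\<Delta>\<^sub>b p = (p(bx) - p(x))/x\<close>, so that \<open>D\<close> is a multiple of \<open>\<Delta>\<^sub>b\<close> for \<open>b = 1/q\<close>. Dividing the
  functional identity by \<open>x\<close> yields the adjoint formula
  \<open>L(\<Delta>\<^sub>1\<^sub>/\<^sub>q p \<cdot> r) = L(p \<cdot> (\<Delta>\<^sub>q r + x^3 r(qx)))\<close> (\<open>qdiff_adjoint\<close>). The right-hand factor has degree
  at most \<open>deg r + 3\<close>, so \<open>\<Delta>\<^sub>1\<^sub>/\<^sub>q P\<^sub>n\<close> is orthogonal to all polynomials of degree below \<open>n - 3\<close>; by
  parity only \<open>P\<^sub>n\<^sub>-\<^sub>1\<close> and \<open>P\<^sub>n\<^sub>-\<^sub>3\<close> survive, with coefficients read off from leading terms. This is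
  \<open>lowering_relation\<close>, the asserted formula for \<open>D P\<^sub>n\<close>.

  For the nonlinear equation let \<open>s\<^sub>n\<close> be the coefficient of \<open>x^(n-2)\<close> in \<open>P\<^sub>n\<close>; the three-term
  recurrence gives \<open>s\<^sub>n\<^sub>+\<^sub>1 = s\<^sub>n - \<alpha>\<^sub>n\<close>. Comparing second coefficients in the lowering relation
  expresses \<open>s\<^sub>n\<close> through the \<open>\<alpha>\<close>'s (\<open>subleading_from_lowering\<close>). Evaluating
  \<open>L(\<Delta>\<^sub>1\<^sub>/\<^sub>q P\<^sub>n \<cdot> x^(n-1))\<close> once by the lowering relation and once by the adjoint formula gives a second
  relation between \<open>s\<^sub>n\<^sub>-\<^sub>1\<close>, \<open>s\<^sub>n\<^sub>+\<^sub>2\<close> and \<open>\<alpha>\<^sub>n\<close> (\<open>subleading_from_adjoint\<close>). Eliminating the \<open>s\<close>'s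
  leaves the nonlinear recurrence.
\<close>

section \<open>Dilations and difference quotients of polynomials\<close>

definition dilate :: "'a::comm_ring_1 \<Rightarrow> 'a poly \<Rightarrow> 'a poly" where
  "dilate a p = pcompose p [:0, a:]"

text \<open>
  The polynomial \<open>(p(a x) - p(x)) / x\<close>: the difference in the numerator has no constant term, so
  \<open>poly_shift 1\<close> is exact division by \<open>x\<close>. Leaving out the usual denominator \<open>a - 1\<close> keeps the
  adjoint formula below free of constants.
\<close>

definition qdiff :: "'a::comm_ring_1 \<Rightarrow> 'a poly \<Rightarrow> 'a poly" where
  "qdiff a p = poly_shift 1 (dilate a p - p)"

lemma coeff_dilate: "coeff (dilate a p) k = a ^ k * coeff p k"
  by (simp add: dilate_def coeff_pcompose_linear)

lemma poly_dilate: "poly (dilate a p) x = poly p (a * x)"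
  by (simp add: dilate_def poly_pcompose mult.commute)

lemma dilate_mult: "dilate a (p * r) = dilate a p * dilate a r"
  by (simp add: dilate_def pcompose_mult)

lemma dilate_dilate: "dilate a (dilate b p) = dilate (a * b) p"
  by (rule poly_eqI) (simp add: coeff_dilate power_mult_distrib)

lemma dilate_1: "dilate 1 p = p"
  by (rule poly_eqI) (simp add: coeff_dilate)

lemma dilate_pCons: "dilate a (pCons b p) = pCons b (smult a (dilate a p))"
  by (rule poly_eqI) (simp add: coeff_dilate coeff_pCons split: nat.split)

lemma coeff_qdiff: "coeff (qdiff a p) k = (a ^ (k + 1) - 1) * coeff p (k + 1)"
  by (simp add: qdiff_def coeff_poly_shift coeff_dilate algebra_simps)

lemma qdiff_pCons: "qdiff a (pCons b p) = smult a (dilate a p) - p"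
  by (rule poly_eqI) (simp add: coeff_qdiff coeff_dilate algebra_simps)

lemma monom_qdiff: "monom 1 1 * qdiff a p = dilate a p - p"
  by (rule poly_eqI) (simp add: coeff_monom_mult coeff_qdiff coeff_dilate left_diff_distrib)

lemma poly_qdiff: "x * poly (qdiff a p) x = poly p (a * x) - poly p x"
  using arg_cong[OF monom_qdiff[of a p], of "\<lambda>r. poly r x"]
  by (simp add: poly_monom poly_dilate)

section \<open>Symmetric functionals with a quartic Pearson equation\<close>

text \<open>
  \<open>L_dilate\<close> is the \<open>q\<close>-analogue of a Pearson equation, satisfied by Jackson integration against any
  weight with \<open>w(qx) = (1 + x^4) w(x)\<close> for which the moments converge.
\<close>

locale quartic_functional =
  fixes q :: real and L :: "real poly \<Rightarrow> real"
  assumes q_pos: "0 < q"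
    and L_add: "L (p + r) = L p + L r"
    and L_smult: "L (smult a p) = a * L p"
    and L_reflect: "L (dilate (- 1) p) = L p"
    and L_dilate: "L (dilate (inverse q) p) = q * L ((1 + monom 1 4) * p)"
    and L_definite: "L (p * p) = 0 \<Longrightarrow> p = 0"
begin

lemma L_0: "L 0 = 0"
  using L_smult[of 0 0] by simp

lemma L_minus: "L (- p) = - L p"
  using L_smult[of "- 1" p] by simp

lemma L_diff: "L (p - r) = L p - L r"
  using L_add[of p "- r"] by (simp add: L_minus)

lemmas L_linear = L_0 L_add L_diff L_minus L_smult

lemma L_cube: "L (monom 1 3) = 0"
proof -
  have "dilate (- 1) (monom 1 3) = - (monom 1 3 :: real poly)"
    by (rule poly_eqI) (simp add: coeff_dilate)
  then show ?thesis
    using L_reflect[of "monom 1 3"] by (simp add: L_minus)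
qed

text \<open>
  Formally this is \<open>L_dilate\<close> applied to \<open>p(x) r(qx) / x\<close>. To stay within polynomials, split off the
  constant term of \<open>p\<close>: the part divisible by \<open>x\<close> is covered by \<open>L_dilate\<close>, and the constant
  contributes \<open>0\<close> on both sides, on the right because \<open>L\<close> annihilates the image of the adjoint.
  The latter is again \<open>L_dilate\<close>, except for the constant term of \<open>r\<close>, where \<open>L(x^3) = 0\<close> is used.
\<close>

lemma qdiff_adjoint:
  "L (qdiff (inverse q) p * r) = L (p * (qdiff q r + monom 1 3 * dilate q r))"
proof -
  obtain a u where p: "p = pCons a u" by (cases p)
  obtain b t where r: "r = pCons b t" by (cases r)
  have p': "p = [:a:] + monom 1 1 * u"
    by (simp add: p monom_altdef)
  have r': "dilate q r = [:b:] + monom 1 1 * smult q (dilate q t)"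
    by (simp add: r dilate_pCons monom_altdef)
  have m4: "monom 1 3 * monom 1 1 = (monom 1 4 :: real poly)"
    by (simp add: mult_monom)
  have inv: "dilate (inverse q) (dilate q s) = s" for s
    using q_pos by (simp add: dilate_dilate dilate_1)
  have "L (smult (inverse q) (dilate (inverse q) u) * r) = L ((1 + monom 1 4) * (u * dilate q r))"
    using L_dilate[of "u * dilate q r"] q_pos by (simp add: dilate_mult inv L_smult)
  moreover have "qdiff (inverse q) p * r = smult (inverse q) (dilate (inverse q) u) * r - u * r"
    by (simp add: p qdiff_pCons algebra_simps)
  ultimately have lhs:
    "L (qdiff (inverse q) p * r) = L ((1 + monom 1 4) * (u * dilate q r)) - L (u * r)"
    by (simp only: L_diff)
  have "qdiff q r + monom 1 3 * dilate q r
      = smult q ((1 + monom 1 4) * dilate q t) - t + smult b (monom 1 3)"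
    unfolding r' by (simp add: r qdiff_pCons distrib_left distrib_right smult_add_right
        mult.assoc[symmetric] m4[simplified] smult_monom monom_Suc[symmetric])
  \<comment> \<open>The adjoint maps into the kernel of \<open>L\<close>.\<close>
  then have const: "L (qdiff q r + monom 1 3 * dilate q r) = 0"
    using L_dilate[of "dilate q t"] by (simp add: L_linear L_cube inv)
  have "p * v = smult a v + u * (monom 1 1 * v)" for v
    by (simp add: p' algebra_simps)
  note this[of "qdiff q r + monom 1 3 * dilate q r"]
  moreover have "monom 1 1 * (qdiff q r + monom 1 3 * dilate q r)
      = dilate q r - r + monom 1 4 * dilate q r"
    unfolding distrib_left monom_qdiff m4[symmetric] by (simp add: mult_ac)
  ultimately have "p * (qdiff q r + monom 1 3 * dilate q r)
      = smult a (qdiff q r + monom 1 3 * dilate q r)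
        + ((1 + monom 1 4) * (u * dilate q r) - u * r)"
    by (simp only:) (simp add: algebra_simps)
  then have "L (p * (qdiff q r + monom 1 3 * dilate q r))
      = a * L (qdiff q r + monom 1 3 * dilate q r)
        + (L ((1 + monom 1 4) * (u * dilate q r)) - L (u * r))"
    by (simp only: L_add L_diff L_smult)
  then show ?thesis
    by (simp add: lhs const)
qed

end

section \<open>Orthogonal polynomials: parity, recurrence and lowering relation\<close>

text \<open>
  Indices are natural numbers here. Truncated subtraction is harmless below: whenever an index such
  as \<open>n - 3\<close> is cut off at \<open>0\<close>, its coefficient contains the factor \<open>\<alpha> 0 = 0\<close> or vanishes otherwise.
\<close>

locale quartic_orthogonal = quartic_functional +
  fixes P :: "nat \<Rightarrow> real poly"
  assumes degree_P: "degree (P n) = n" and monic_P: "coeff (P n) n = 1"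
    and orthogonal_P: "n \<noteq> m \<Longrightarrow> L (P n * P m) = 0"
begin

lemma coeff_P_above: "n < k \<Longrightarrow> coeff (P n) k = 0"
  by (simp add: coeff_eq_0 degree_P)

text \<open>
  Subtracting multiples of \<open>P m\<close> from the top coefficient downwards, \<open>P n\<close> is orthogonal to every
  polynomial of lower degree. Degree bounds are written as vanishing coefficients, so that the zero
  polynomial needs no separate treatment.
\<close>

lemma L_P_mult:
  assumes "\<And>k. n < k \<Longrightarrow> coeff r k = 0"
  shows "L (P n * r) = coeff r n * L (P n * P n)"
proof -
  have below: "L (P n * s) = 0" if "m \<le> n" and "\<And>k. m \<le> k \<Longrightarrow> coeff s k = 0" for m s
    using that
  proof (induction m arbitrary: s)
    case 0
    then have "s = 0" by (intro poly_eqI) simp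
    then show ?case by (simp add: L_0)
  next
    case (Suc m)
    define s' where "s' = s - smult (coeff s m) (P m)"
    have "coeff s' k = 0" if "m \<le> k" for k
      using Suc.prems(2)[of k] that coeff_P_above[of m k] monic_P[of m]
      by (cases "k = m") (simp_all add: s'_def)
    then have "L (P n * s') = 0"
      using Suc by simp
    moreover have "P n * s = P n * s' + smult (coeff s m) (P n * P m)"
      by (simp add: s'_def algebra_simps)
    ultimately show ?case
      using Suc.prems(1) orthogonal_P[of n m] by (simp add: L_linear)
  qed
  define r' where "r' = r - smult (coeff r n) (P n)"
  have "coeff r' k = 0" if "n \<le> k" for k
    using assms[of k] that coeff_P_above[of n k] monic_P[of n]
    by (cases "k = n") (simp_all add: r'_def)
  then have "L (P n * r') = 0"
    using below[of n r'] by simp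
  moreover have "P n * r = P n * r' + smult (coeff r n) (P n * P n)"
    by (simp add: r'_def algebra_simps)
  ultimately show ?thesis
    by (simp add: L_linear)
qed

lemma L_P_mult_lower: "(\<And>k. n \<le> k \<Longrightarrow> coeff r k = 0) \<Longrightarrow> L (P n * r) = 0"
  using L_P_mult[of n r] by simp

lemma norm_P_nonzero: "L (P n * P n) \<noteq> 0"
  using L_definite[of "P n"] monic_P[of n] by auto

text \<open>
  The polynomial \<open>(-1)^n P n (-x)\<close> is monic and satisfies the same orthogonality, because \<open>L\<close> is
  invariant under reflection. Its difference \<open>r\<close> to \<open>P n\<close> has lower degree and is therefore orthogonal
  to itself, hence zero.
\<close>

lemma coeff_P_parity:
  assumes "odd (n + k)"
  shows "coeff (P n) k = 0"
proof -
  define r where "r = smult ((- 1) ^ n) (dilate (- 1) (P n)) - P n"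
  have low: "coeff r k = 0" if "n \<le> k" for k
    using that coeff_P_above[of n k]
    by (cases "k = n") (simp_all add: r_def coeff_dilate mult.assoc[symmetric] power_mult_distrib[symmetric])
  have "L (dilate (- 1) (P n) * r) = L (dilate (- 1) (dilate (- 1) (P n) * r))"
    by (simp add: L_reflect)
  also have "\<dots> = L (P n * dilate (- 1) r)"
    by (simp add: dilate_mult dilate_dilate dilate_1)
  also have "\<dots> = 0"
    by (rule L_P_mult_lower) (simp add: coeff_dilate low)
  finally have "L (dilate (- 1) (P n) * r) = 0" .
  moreover have "L (P n * r) = 0"
    by (rule L_P_mult_lower) (rule low)
  moreover have "r * r = smult ((- 1) ^ n) (dilate (- 1) (P n) * r) - P n * r"
    by (subst (1) r_def) (simp add: algebra_simps)
  ultimately have "L (r * r) = 0"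
    by (simp add: L_linear)
  then have "coeff r k = 0"
    using L_definite[of r] by simp
  moreover have "(- 1) ^ n * (- 1) ^ k = (- 1 :: real)"
    using assms by (metis power_add uminus_power_if power_one)
  ultimately show ?thesis
    by (simp add: r_def coeff_dilate mult.assoc[symmetric])
qed

definition \<alpha> :: "nat \<Rightarrow> real" where
  "\<alpha> n = (if n = 0 then 0 else L (P n * P n) / L (P (n - 1) * P (n - 1)))"

lemma alpha_0: "\<alpha> 0 = 0"
  by (simp add: \<alpha>_def)

lemma norm_P_Suc: "L (P (Suc n) * P (Suc n)) = \<alpha> (Suc n) * L (P n * P n)"
  using norm_P_nonzero[of n] by (simp add: \<alpha>_def)

text \<open>
  By parity \<open>x P n - P (n + 1)\<close> has degree at most \<open>n - 1\<close>. The remainder \<open>r\<close> is orthogonal to itself: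
  in \<open>L(r\<^sup>2)\<close> the factor \<open>x\<close> moves over to \<open>r\<close>, only the coefficient of \<open>x^(n-1)\<close> in \<open>r\<close> matters, and
  the two contributions cancel by the choice of \<open>\<alpha> n\<close> as a quotient of squared norms.
\<close>

lemma three_term_recurrence: "monom 1 1 * P n = P (n + 1) + smult (\<alpha> n) (P (n - 1))"
proof -
  define r where "r = monom 1 1 * P n - P (n + 1) - smult (\<alpha> n) (P (n - 1))"
  have xP: "coeff (monom 1 1 * P n - P (n + 1)) k = 0" if "n \<le> k" for k
  proof -
    have "k = n \<or> k = n + 1 \<or> n + 1 < k" using that by linarith
    then show ?thesis
      by (elim disjE) (use coeff_P_parity[of n "n - 1"] in
          \<open>auto simp: coeff_monom_mult coeff_P_above coeff_P_parity monic_P\<close>)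
  qed
  have "r = 0"
  proof (cases n)
    case 0
    then show ?thesis
      using xP by (intro poly_eqI) (simp add: r_def alpha_0)
  next
    case (Suc m)
    have r_low: "coeff r k = 0" if "n \<le> k" for k
      using xP[OF that] that coeff_P_above[of "n - 1" k] Suc by (simp add: r_def)
    have P_r: "L (P j * r) = 0" if "n \<le> j" for j
      using r_low that by (intro L_P_mult_lower) auto
    have shift: "coeff (monom 1 1 * s) k = 0" if "\<And>k. i \<le> k \<Longrightarrow> coeff s k = 0" "i < k" for i k and s :: "real poly"
      using that by (simp add: coeff_monom_mult)
    have x_P: "L (P n * (monom 1 1 * s)) = coeff s m * L (P n * P n)"
      if "\<And>k. n \<le> k \<Longrightarrow> coeff s k = 0" for s
      using L_P_mult[of n "monom 1 1 * s"] shift[of n s] that Suc by (simp add: coeff_monom_mult)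
    have "L (r * r) = L (P n * (monom 1 1 * r)) - L (P (n + 1) * r) - \<alpha> n * L (P m * r)"
      using Suc by (subst (1) r_def) (simp add: algebra_simps L_linear)
    also have "L (P m * r) = coeff r m * L (P m * P m)"
      using r_low Suc by (intro L_P_mult) auto
    also have "L (P n * (monom 1 1 * r)) = coeff r m * L (P n * P n)"
      using r_low by (rule x_P)
    finally have "L (r * r) = 0"
      using norm_P_Suc[of m] P_r[of "n + 1"] Suc by (simp add: algebra_simps)
    then show ?thesis by (rule L_definite)
  qed
  then show ?thesis
    by (simp add: r_def algebra_simps)
qed

text \<open>
  Let \<open>r\<close> be the difference of the two sides. Its coefficient of \<open>x^(n-1)\<close> cancels and that of
  \<open>x^(n-2)\<close> vanishes by parity, so \<open>r\<close> has degree at most \<open>n - 3\<close>. By the adjoint formula, pairing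
  \<open>\<Delta> P n\<close> with such an \<open>r\<close> only sees the top coefficient of \<open>x^3 r(qx)\<close>, which is \<open>q^(n-3)\<close>
  times that of \<open>r\<close>; since the squared norms of \<open>P n\<close> and \<open>P (n - 3)\<close> differ by the factor \<open>\<alpha> n \<alpha> (n-1) \<alpha> (n-2)\<close>, this is exactly what
  the multiple of \<open>P (n - 3)\<close> contributes. Thus \<open>L(r\<^sup>2) = 0\<close>.
\<close>

lemma lowering_relation:
  "qdiff (inverse q) (P n)
     = smult (inverse q ^ n - 1) (P (n - 1))
       + smult (q ^ (n - 3) * \<alpha> n * \<alpha> (n - 1) * \<alpha> (n - 2)) (P (n - 3))"
proof -
  define K where "K = q ^ (n - 3) * \<alpha> n * \<alpha> (n - 1) * \<alpha> (n - 2)"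
  define r where "r = qdiff (inverse q) (P n) - smult (inverse q ^ n - 1) (P (n - 1)) - smult K (P (n - 3))"
  have K_small: "K = 0" if "n < 3"
  proof -
    have "n = 0 \<or> n - 1 = 0 \<or> n - 2 = 0" using that by linarith
    then show ?thesis by (auto simp: K_def alpha_0)
  qed
  have r_low: "coeff r k = 0" if "n - 2 \<le> k" for k
  proof -
    have "K * coeff (P (n - 3)) k = 0"
      using K_small coeff_P_above[of "n - 3" k] that by (cases "n < 3") auto
    moreover have "n = 0 \<or> n = k + 1 \<or> n = k + 2 \<or> 0 < n \<and> n - 1 < k"
      using that by linarith
    ultimately show ?thesis
      by (elim disjE) (auto simp: r_def coeff_qdiff coeff_P_above coeff_P_parity monic_P)
  qed
  have "r = 0"
  proof (cases "n < 3")
    case True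
    then show ?thesis using r_low by (intro poly_eqI) simp
  next
    case False
    define m where "m = n - 3"
    have n: "n = Suc (Suc (Suc m))" using False by (simp add: m_def)
    have r0: "coeff r k = 0" if "m < k" for k
      using r_low[of k] that n by simp
    have "L (qdiff (inverse q) (P n) * r) = L (P n * (qdiff q r + monom 1 3 * dilate q r))"
      by (rule qdiff_adjoint)
    also have "\<dots> = coeff (qdiff q r + monom 1 3 * dilate q r) n * L (P n * P n)"
      by (rule L_P_mult) (simp add: coeff_qdiff coeff_monom_mult coeff_dilate n r0)
    also have "coeff (qdiff q r + monom 1 3 * dilate q r) n = q ^ m * coeff r m"
      by (simp add: coeff_qdiff coeff_monom_mult coeff_dilate n r0)
    also have "q ^ m * coeff r m * L (P n * P n) = K * L (P m * r)"
      using L_P_mult[of m r] r0 by (simp add: K_def n norm_P_Suc)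
    finally have "L (qdiff (inverse q) (P n) * r) = K * L (P m * r)" .
    moreover have "L (P (n - 1) * r) = 0"
      using r0 n by (intro L_P_mult_lower) auto
    moreover have "r * r = qdiff (inverse q) (P n) * r
        - smult (inverse q ^ n - 1) (P (n - 1) * r) - smult K (P m * r)"
      by (subst (1) r_def) (simp add: algebra_simps n)
    ultimately have "L (r * r) = 0"
      by (simp add: L_linear)
    then show ?thesis by (rule L_definite)
  qed
  then show ?thesis
    by (simp add: r_def K_def algebra_simps)
qed

section \<open>Subleading coefficients and the nonlinear recurrence\<close>

definition subleading :: "nat \<Rightarrow> real" where
  "subleading n = (if n < 2 then 0 else coeff (P n) (n - 2))"

lemma subleading_Suc: "subleading (Suc n) = subleading n - \<alpha> n"
proof (cases n)
  case 0
  then show ?thesis by (simp add: subleading_def alpha_0)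
next
  case (Suc m)
  then show ?thesis
    using arg_cong[OF three_term_recurrence[of n], of "\<lambda>p. coeff p m"]
    by (auto simp: coeff_monom_mult subleading_def monic_P split: if_splits)
qed

text \<open>
  Coefficient of \<open>x^(n-1)\<close> in the lowering relation for \<open>P (n + 2)\<close>, after eliminating
  \<open>subleading (n + 2)\<close>.
\<close>

lemma subleading_from_lowering:
  "(inverse q ^ n - 1) * \<alpha> (Suc n) + q ^ n / q * \<alpha> (n + 2) * \<alpha> (n + 1) * \<alpha> n
     = (1 - inverse q ^ 2) * inverse q ^ n * subleading (Suc n)"
proof (cases n)
  case 0
  then show ?thesis by (simp add: subleading_def alpha_0)
next
  case (Suc m)
  have "coeff (qdiff (inverse q) (P (m + 3))) m = (inverse q ^ (m + 1) - 1) * subleading (m + 3)"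
    by (simp add: coeff_qdiff subleading_def)
  moreover have "coeff (P (m + 2)) m = subleading (m + 2)"
    by (simp add: subleading_def)
  ultimately have "(inverse q ^ (m + 1) - 1) * subleading (m + 3)
      = (inverse q ^ (m + 3) - 1) * subleading (m + 2) + q ^ m * \<alpha> (m + 3) * \<alpha> (m + 2) * \<alpha> (m + 1)"
    using arg_cong[OF lowering_relation[of "m + 3"], of "\<lambda>p. coeff p m"]
    by (simp add: monic_P numeral_eq_Suc)
  moreover have "subleading (m + 3) = subleading (m + 2) - \<alpha> (m + 2)"
    using subleading_Suc[of "m + 2"] by (simp add: numeral_eq_Suc)
  ultimately show ?thesis
    using q_pos by (simp add: Suc numeral_eq_Suc) (simp add: algebra_simps)
qed

text \<open>
  The difference \<open>x^(n+2) - P (n + 2)\<close> has degree at most \<open>n\<close> by parity, and \<open>P (n + 2)\<close> is orthogonal to \<open>P n\<close>.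
\<close>

lemma L_P_power: "L (P n * monom 1 (n + 2)) = - subleading (n + 2) * L (P n * P n)"
proof -
  have "coeff (monom 1 (n + 2) - P (n + 2)) k = 0" if "n < k" for k
  proof -
    have "k = n + 1 \<or> k = n + 2 \<or> n + 2 < k" using that by linarith
    then show ?thesis
      by (elim disjE) (auto simp: coeff_P_above coeff_P_parity monic_P)
  qed
  then have "L (P n * (monom 1 (n + 2) - P (n + 2))) = - subleading (n + 2) * L (P n * P n)"
    using L_P_mult[of n "monom 1 (n + 2) - P (n + 2)"] by (simp add: subleading_def)
  then show ?thesis
    using orthogonal_P[of n "n + 2"] by (simp add: right_diff_distrib L_diff)
qed

text \<open>
  Two evaluations of \<open>L(\<Delta> P (n + 1) \<cdot> x^n)\<close>. The adjoint formula gives \<open>q^n L(P (n + 1) x^(n+3))\<close>, the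
  lowering relation gives \<open>(q^-(n+1) - 1) L(P n x^n)\<close> plus a multiple of \<open>L(P (n - 2) x^n)\<close>; the moments
  of this kind are known from \<open>L_P_power\<close>.
\<close>

lemma subleading_from_adjoint:
  "\<alpha> (Suc n) * (q ^ n / q ^ 2 * subleading n - q ^ n * subleading (n + 3)) = inverse q ^ (n + 1) - 1"
proof -
  let ?x = "monom 1 n :: real poly"
  have x: "qdiff q ?x + monom 1 3 * dilate q ?x = (if n = 0 then 0 else monom (q ^ n - 1) (n - 1)) + monom (q ^ n) (n + 3)"
    by (rule poly_eqI) (auto simp: coeff_qdiff coeff_dilate coeff_monom_mult)
  have "L (P (n + 1) * (if n = 0 then 0 else monom (q ^ n - 1) (n - 1))) = 0"
    by (rule L_P_mult_lower) auto
  moreover have "monom (q ^ n) (n + 3) = smult (q ^ n) (monom 1 (n + 3))"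
    by (simp add: smult_monom)
  ultimately have "L (qdiff (inverse q) (P (n + 1)) * ?x) = - (q ^ n * subleading (n + 3)) * L (P (n + 1) * P (n + 1))"
    using L_P_power[of "n + 1"] unfolding qdiff_adjoint x
    by (simp add: distrib_left L_linear numeral_eq_Suc)
  moreover have "L (P n * ?x) = L (P n * P n)"
    using L_P_mult[of n ?x] by simp
  moreover have "q ^ (n - 2) * \<alpha> (n + 1) * \<alpha> n * \<alpha> (n - 1) * L (P (n - 2) * ?x)
      = - (q ^ n / q ^ 2) * subleading n * L (P (n + 1) * P (n + 1))"
  proof (cases "n < 2")
    case True
    then have "n = 0 \<or> n - 1 = 0" by linarith
    then show ?thesis using True by (auto simp: subleading_def alpha_0)
  next
    case False
    define m where "m = n - 2"
    have n: "n = Suc (Suc m)" using False by (simp add: m_def)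
    show ?thesis
      using L_P_power[of m] q_pos by (simp add: n norm_P_Suc power2_eq_square)
  qed
  moreover have "qdiff (inverse q) (P (n + 1)) * ?x
      = smult (inverse q ^ (n + 1) - 1) (P n * ?x)
        + smult (q ^ (n - 2) * \<alpha> (n + 1) * \<alpha> n * \<alpha> (n - 1)) (P (n - 2) * ?x)"
    unfolding lowering_relation by (simp add: distrib_right numeral_eq_Suc)
  ultimately have "(inverse q ^ (n + 1) - 1) * L (P n * P n)
      - q ^ n / q ^ 2 * subleading n * L (P (n + 1) * P (n + 1)) = - (q ^ n * subleading (n + 3)) * L (P (n + 1) * P (n + 1))"
    by (simp add: L_linear)
  then have "(inverse q ^ (n + 1) - 1) * L (P n * P n)
      = \<alpha> (Suc n) * (q ^ n / q ^ 2 * subleading n - q ^ n * subleading (n + 3)) * L (P n * P n)"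
    by (simp add: norm_P_Suc algebra_simps)
  then show ?thesis
    using norm_P_nonzero[of n] by simp
qed

text \<open>
  By \<open>subleading_Suc\<close> both \<open>subleading n\<close> and \<open>subleading (n + 3)\<close> can be written through
  \<open>subleading (n + 1)\<close>, whose total coefficient in \<open>subleading_from_adjoint\<close> is proportional to
  \<open>q^(-2) - 1\<close>; that multiple is what \<open>subleading_from_lowering\<close> provides.
\<close>

theorem nonlinear_recurrence:
  "\<alpha> (n + 1) * (\<alpha> (n + 2) + q ^ n * \<alpha> (n + 1) + inverse q ^ 2 * \<alpha> n
      - q ^ (2 * n) / q * \<alpha> (n + 2) * \<alpha> (n + 1) * \<alpha> n)
    = (inverse q ^ (n + 1) - 1) * inverse q ^ n"
proof -
  define t where "t = q ^ n"
  have t: "t \<noteq> 0" "inverse q ^ n = 1 / t" "q ^ (2 * n) = t * t"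
    using q_pos by (simp_all add: t_def power_inverse divide_inverse power_even_eq power2_eq_square mult_2 power_add)
  have a_n: "subleading n = subleading (Suc n) + \<alpha> n"
    using subleading_Suc[of n] by simp
  have a_n3: "subleading (n + 3) = subleading (Suc n) - \<alpha> (n + 1) - \<alpha> (n + 2)"
    using subleading_Suc[of "n + 1"] subleading_Suc[of "n + 2"] by (simp add: numeral_eq_Suc)
  have low: "(1 / t - 1) * \<alpha> (n + 1) + t / q * \<alpha> (n + 2) * \<alpha> (n + 1) * \<alpha> n
      = (1 - inverse q ^ 2) / t * subleading (Suc n)"
    using subleading_from_lowering[of n] t by (simp add: t_def[symmetric])
  have a_low: "(inverse q ^ 2 - 1) * subleading (Suc n)
      = - ((1 - t) * \<alpha> (n + 1) + t * t / q * \<alpha> (n + 2) * \<alpha> (n + 1) * \<alpha> n)"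
    using low t(1) by (simp add: field_simps)
  have "\<alpha> (n + 1) * (inverse q ^ 2 * subleading n - subleading (n + 3)) = (inverse q ^ (n + 1) - 1) * inverse q ^ n"
  proof -
    have "t / q ^ 2 * subleading n - t * subleading (n + 3) = t * (inverse q ^ 2 * subleading n - subleading (n + 3))"
      by (simp add: field_simps)
    then have "t * (\<alpha> (n + 1) * (inverse q ^ 2 * subleading n - subleading (n + 3))) = inverse q ^ (n + 1) - 1"
      using subleading_from_adjoint[of n] by (simp add: t_def mult.left_commute)
    then show ?thesis
      using t(1) unfolding t(2) by (simp add: field_simps)
  qed
  moreover have "inverse q ^ 2 * subleading n - subleading (n + 3)
      = \<alpha> (n + 2) + t * \<alpha> (n + 1) + inverse q ^ 2 * \<alpha> n
        - t * t / q * \<alpha> (n + 2) * \<alpha> (n + 1) * \<alpha> n"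
    using a_low unfolding a_n a_n3 by (simp add: algebra_simps)
  ultimately show ?thesis
    by (simp add: t(3) t_def[symmetric])
qed

end

section \<open>The weight function\<close>

lemma qpoch_inf_minus:
  fixes b y :: real
  assumes "0 < b" "b < 1" "0 \<le> y"
  shows qpoch_inf_minus_shift: "qpoch_inf (- y) b = (1 + y) * qpoch_inf (- (y * b)) b"
    and qpoch_inf_minus_ge_prod: "(\<Prod>i<n. y * b ^ i) \<le> qpoch_inf (- y) b"
    and qpoch_inf_minus_ge_1: "1 \<le> qpoch_inf (- y) b"
proof -
  let ?f = "\<lambda>j. 1 + y * b ^ j"
  have "summable (\<lambda>j. \<bar>y * b ^ j\<bar>)"
    using assms by (simp add: abs_mult summable_mult summable_geometric)
  moreover have nonneg: "0 \<le> y * b ^ j" for j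
    using assms by simp
  ultimately have conv: "convergent_prod ?f"
    by (intro summable_imp_convergent_prod_real) (metis neg_0_le_iff_le zero_less_one not_le)+
  have eq: "qpoch_inf (- y) b = prodinf ?f"
    by (simp add: qpoch_inf_def)
  have "?f 0 \<noteq> 0" using assms by simp
  then show "qpoch_inf (- y) b = (1 + y) * qpoch_inf (- (y * b)) b"
    using prodinf_split_head[OF conv] unfolding eq by (simp add: qpoch_inf_def mult.assoc)
  have ge: "prod ?f {..<n} \<le> qpoch_inf (- y) b" for n
    unfolding eq using nonneg by (intro prod_le_prodinf[OF convergent_prod_has_prod[OF conv]]) auto
  show "1 \<le> qpoch_inf (- y) b"
    using ge[of 0] by simp
  have "(\<Prod>i<n. y * b ^ i) \<le> prod ?f {..<n}"
    using nonneg by (intro prod_mono) simp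
  then show "(\<Prod>i<n. y * b ^ i) \<le> qpoch_inf (- y) b"
    using ge[of n] by simp
qed

context
  fixes q :: real
  assumes q: "0 < q" "q < 1"
begin

lemma q4: "0 < q ^ 4" "q ^ 4 < 1"
  using q by (simp_all add: power_Suc_less_one power_less_one_iff)

lemma weight_pos: "0 < weight q x" and weight_le_1: "weight q x \<le> 1"
  using qpoch_inf_minus_ge_1[OF q4, of "x ^ 4"] by (simp_all add: weight_def)

lemma weight_minus: "weight q (- x) = weight q x"
  by (simp add: weight_def)

lemma weight_dilate: "weight q (q * x) = (1 + x ^ 4) * weight q x"
proof -
  have "0 < 1 + x ^ 4" by (simp add: add_pos_nonneg)
  then show ?thesis
    using qpoch_inf_minus_shift[OF q4, of "x ^ 4"]
    by (simp add: weight_def power_mult_distrib mult.commute)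
qed

text \<open>
  The first \<open>m\<close> factors of the infinite product already dominate a positive multiple of \<open>x^(4m)\<close>, so the
  weight decays faster than any power.
\<close>

lemma power_weight_bounded: "\<exists>B. \<forall>x. \<bar>x\<bar> ^ m * weight q x \<le> B"
proof -
  define C where "C = (\<Prod>i<m. (q ^ 4) ^ i)"
  have C: "0 < C" using q by (auto simp: C_def intro: prod_pos)
  have "\<bar>x\<bar> ^ m * weight q x \<le> 1 + 1 / C" for x
  proof -
    have "\<bar>x\<bar> ^ m \<le> 1 + (x ^ 4) ^ m"
    proof (cases "\<bar>x\<bar> \<le> 1")
      case True
      then have "\<bar>x\<bar> ^ m \<le> 1" by (simp add: power_le_one)
      then show ?thesis by (simp add: add_increasing2)
    next
      case False
      then have "\<bar>x\<bar> ^ m \<le> (\<bar>x\<bar> ^ 4) ^ m"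
        by (intro power_mono self_le_power) auto
      then show ?thesis by simp
    qed
    then have "\<bar>x\<bar> ^ m * weight q x \<le> (1 + (x ^ 4) ^ m) * weight q x"
      using weight_pos[of x] by (intro mult_right_mono) auto
    also have "\<dots> = weight q x + (x ^ 4) ^ m * weight q x"
      by (simp add: distrib_right)
    also have "(x ^ 4) ^ m * weight q x \<le> 1 / C"
    proof -
      have "(x ^ 4) ^ m * C \<le> qpoch_inf (- (x ^ 4)) (q ^ 4)"
        using qpoch_inf_minus_ge_prod[OF q4, of "x ^ 4" m] by (simp add: C_def prod.distrib)
      moreover have "0 < qpoch_inf (- (x ^ 4)) (q ^ 4)"
        using qpoch_inf_minus_ge_1[OF q4, of "x ^ 4"] by simp
      ultimately show ?thesis
        using C by (simp add: weight_def divide_simps)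
    qed
    finally show ?thesis
      using weight_le_1[of x] by simp
  qed
  then show ?thesis by blast
qed

lemma poly_weight_bounded: "\<exists>B. \<forall>x. \<bar>poly p x * weight q x\<bar> \<le> B"
proof -
  obtain B where B: "\<And>m x. \<bar>x\<bar> ^ m * weight q x \<le> B m"
    using power_weight_bounded by metis
  have "\<bar>poly p x * weight q x\<bar> \<le> (\<Sum>i\<le>degree p. \<bar>coeff p i\<bar> * B i)" for x
  proof -
    have "\<bar>poly p x * weight q x\<bar> = \<bar>\<Sum>i\<le>degree p. coeff p i * x ^ i * weight q x\<bar>"
      by (simp add: poly_altdef sum_distrib_right)
    also have "\<dots> \<le> (\<Sum>i\<le>degree p. \<bar>coeff p i * x ^ i * weight q x\<bar>)"
      by (rule sum_abs)
    also have "\<dots> = (\<Sum>i\<le>degree p. \<bar>coeff p i\<bar> * (\<bar>x\<bar> ^ i * weight q x))"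
      using weight_pos[of x] by (simp add: abs_mult power_abs mult.assoc)
    also have "\<dots> \<le> (\<Sum>i\<le>degree p. \<bar>coeff p i\<bar> * B i)"
      by (intro sum_mono mult_left_mono B) simp
    finally show ?thesis .
  qed
  then show ?thesis by blast
qed

section \<open>The Jackson integral as a functional\<close>

lemma summable_on_power_abs: "(\<lambda>k::int. q ^ nat \<bar>k\<bar>) summable_on UNIV"
proof -
  have geo: "(\<lambda>n. q ^ n) summable_on UNIV" "(\<lambda>n. q ^ Suc n) summable_on UNIV"
    using q by (auto intro!: norm_summable_imp_summable_on summable_mult simp: norm_mult norm_power summable_geometric)
  have "(\<lambda>k::int. q ^ nat \<bar>k\<bar>) summable_on range int"
    using geo(1) by (subst summable_on_reindex) (auto simp: o_def)
  moreover have "(\<lambda>k::int. q ^ nat \<bar>k\<bar>) summable_on range (\<lambda>n. - int (Suc n))"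
    using geo(2) by (subst summable_on_reindex) (auto simp: o_def inj_on_def nat_add_distrib)
  moreover have "range int \<inter> range (\<lambda>n. - int (Suc n)) = {}"
    by auto
  moreover have "range int \<union> range (\<lambda>n. - int (Suc n)) = UNIV"
    by (metis (no_types, lifting) UNIV_eq_I UnCI int_cases rangeI)
  ultimately show ?thesis
    using summable_on_Un_disjoint by metis
qed

text \<open>
  The nodes \<open>q^k\<close> accumulate at \<open>0\<close>, where the factor \<open>q^k\<close> gives convergence for bounded \<open>f\<close>, and
  escape to infinity, where decay like \<open>1/x^2\<close> turns the factor \<open>q^k\<close> into \<open>q^(-k)\<close>.
\<close>

lemma jackson_summable:
  assumes "\<And>x. \<bar>f x\<bar> \<le> B" and "\<And>x. x\<^sup>2 * \<bar>f x\<bar> \<le> B"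
  shows "(\<lambda>k::int. q powi k * (f (q powi k) + f (- (q powi k)))) summable_on UNIV"
    (is "?F summable_on UNIV")
proof -
  have bound: "norm (?F k) \<le> norm (2 * B * q ^ nat \<bar>k\<bar>)" for k
  proof -
    define x where "x = q powi k"
    have x: "0 < x" using q by (simp add: x_def)
    have B: "0 \<le> B" using assms(1)[of 0] by linarith
    have one: "x * \<bar>f y\<bar> \<le> B * q ^ nat \<bar>k\<bar>" if "\<bar>y\<bar> = x" for y
    proof (cases "0 \<le> k")
      case True
      then have "x = q ^ nat \<bar>k\<bar>" by (simp add: x_def power_int_def)
      then show ?thesis
        using mult_right_mono[OF assms(1)[of y], of x] x by (simp add: mult.commute)
    next
      case False
      then have eq: "q ^ nat \<bar>k\<bar> = inverse x"
        by (simp add: x_def power_int_def power_inverse)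
      have "y\<^sup>2 = x * x"
        using that by (metis power2_abs power2_eq_square)
      then have "x * (x * \<bar>f y\<bar>) \<le> B"
        using assms(2)[of y] by (simp add: mult.assoc)
      then show ?thesis
        using x by (simp add: eq field_simps)
    qed
    have "norm (x * (f x + f (- x))) \<le> x * \<bar>f x\<bar> + x * \<bar>f (- x)\<bar>"
      using x by (simp add: abs_mult distrib_left[symmetric] abs_triangle_ineq)
    also have "\<dots> \<le> 2 * B * q ^ nat \<bar>k\<bar>"
      using one[of x] one[of "- x"] x by simp
    also have "\<dots> = norm (2 * B * q ^ nat \<bar>k\<bar>)"
      using B q by simp
    finally show ?thesis
      by (simp add: x_def)
  qed
  have "(\<lambda>k::int. norm (2 * B * q ^ nat \<bar>k\<bar>)) summable_on UNIV"
    by (intro iffD1[OF summable_on_iff_abs_summable_on_real] summable_on_cmult_right summable_on_power_abs)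
  then have "(\<lambda>k. norm (?F k)) summable_on UNIV"
    by (rule Infinite_Sum.abs_summable_on_comparison_test) (rule bound)
  then show ?thesis
    by (rule Infinite_Sum.abs_summable_summable)
qed

lemma jackson_integral_dilate: "jackson_integral q f = q * jackson_integral q (\<lambda>x. f (q * x))"
proof -
  let ?F = "\<lambda>k::int. q powi k * (f (q powi k) + f (- (q powi k)))"
  have "bij_betw (\<lambda>k::int. k + 1) UNIV UNIV"
    by (rule bij_betwI[of _ _ _ "\<lambda>k. k - 1"]) auto
  then have "infsum ?F UNIV = infsum (\<lambda>k. ?F (k + 1)) UNIV"
    by (rule infsum_reindex_bij_betw[symmetric])
  also have "\<dots> = (\<Sum>\<^sub>\<infinity>k\<in>UNIV. q * (q powi k * (f (q * q powi k) + f (q * - (q powi k)))))"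
    using q by (intro infsum_cong) (simp add: power_int_add mult_ac)
  also have "\<dots> = q * jackson_integral q (\<lambda>x. f (q * x))"
    unfolding jackson_integral_def by (rule infsum_cmult_right')
  finally show ?thesis
    by (simp add: jackson_integral_def)
qed

text \<open>
  Definiteness holds because the nodes \<open>c q^n\<close> are infinitely many points of positive mass, and only the
  zero polynomial vanishes at all of them.
\<close>

lemma jackson_functional:
  assumes c: "0 < c"
  shows "quartic_functional q (\<lambda>p. jackson_integral q (\<lambda>x. poly p (c * x) * weight q (c * x)))"
    (is "quartic_functional q ?L")
proof
  let ?T = "\<lambda>p (k::int). q powi k * (poly p (c * q powi k) * weight q (c * q powi k)
              + poly p (c * - (q powi k)) * weight q (c * - (q powi k)))"
  have summable: "?T p summable_on UNIV" for p
  proof -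
    obtain B0 where B0: "\<And>x. \<bar>poly p x * weight q x\<bar> \<le> B0"
      using poly_weight_bounded by blast
    obtain B2 where B2: "\<And>x. \<bar>poly (monom 1 2 * p) x * weight q x\<bar> \<le> B2"
      using poly_weight_bounded by blast
    have "x\<^sup>2 * \<bar>poly p (c * x) * weight q (c * x)\<bar> \<le> B2 / c\<^sup>2" for x
      using B2[of "c * x"] c by (simp add: poly_monom abs_mult power_mult_distrib field_simps)
    then show ?thesis
      using B0 by (intro jackson_summable[where B = "max B0 (B2 / c\<^sup>2)"]) (auto simp: le_max_iff_disj)
  qed
  show "0 < q" by (rule q)
  show "?L (p + r) = ?L p + ?L r" for p r
    unfolding jackson_integral_def infsum_add[OF summable summable, symmetric]
    by (simp add: algebra_simps)
  show "?L (smult a p) = a * ?L p" for a p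
    unfolding jackson_integral_def infsum_cmult_right'[symmetric]
    by (simp add: algebra_simps)
  show "?L (dilate (- 1) p) = ?L p" for p
    by (simp add: jackson_integral_def poly_dilate weight_minus add.commute)
  show "?L (dilate (inverse q) p) = q * ?L ((1 + monom 1 4) * p)" for p
  proof -
    have "poly (dilate (inverse q) p) (c * (q * x)) * weight q (c * (q * x))
        = poly ((1 + monom 1 4) * p) (c * x) * weight q (c * x)" for x
    proof -
      have x: "inverse q * (c * (q * x)) = c * x" "c * (q * x) = q * (c * x)"
        using q by simp_all
      show ?thesis
        unfolding poly_dilate x(1) unfolding x(2) weight_dilate by (simp add: poly_monom)
    qed
    then show ?thesis
      by (subst jackson_integral_dilate) simp
  qed
  show "p = 0" if "?L (p * p) = 0" for p
  proof (rule ccontr)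
    assume "p \<noteq> 0"
    have nonneg: "0 \<le> poly (p * p) x * weight q x" for x
      using weight_pos[of x] by simp
    have "poly p (c * q ^ n) = 0" for n
    proof -
      have "?T (p * p) (int n) = 0"
        using nonneg_infsum_le_0D[of "?T (p * p)" UNIV "int n"] that summable[of "p * p"] nonneg q
        by (auto simp: jackson_integral_def)
      then have "poly (p * p) (c * q ^ n) * weight q (c * q ^ n) = 0"
        using nonneg[of "c * q ^ n"] nonneg[of "c * - (q ^ n)"] q
        by (simp add: add_nonneg_eq_0_iff)
      then show ?thesis
        using weight_pos[of "c * q ^ n"] by simp
    qed
    then have "range (\<lambda>n. c * q ^ n) \<subseteq> {x. poly p x = 0}"
      by auto
    moreover have "inj (\<lambda>n. c * q ^ n)"
      using c q by (auto intro!: injI simp: power_inject_exp')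
    ultimately show False
      using poly_roots_finite[OF \<open>p \<noteq> 0\<close>] finite_subset range_inj_infinite by blast
  qed
qed

end

section \<open>The recurrence coefficients for the Jackson integral\<close>

theorem theorem8p2:
  fixes q c :: real and P :: "int \<Rightarrow> real poly" and \<gamma> :: "int \<Rightarrow> real"
  assumes "0 < q" and "q < 1" and "q < c" and "c \<le> 1"
    and "monic_sequence P"
    and "orthogonal_sequence q c P \<gamma>"
  shows "(\<exists>!\<alpha>. recurrence_coeffs P \<alpha>) \<and>
    (\<forall>\<alpha>. recurrence_coeffs P \<alpha> \<longrightarrow>
       (\<forall>n\<ge>1. \<alpha> n * (\<alpha> (n + 1) + q powi (n - 1) * \<alpha> n + q powi (- 2) * \<alpha> (n - 1)
                  - q powi (2 * n - 3) * \<alpha> (n + 1) * \<alpha> n * \<alpha> (n - 1))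
                = (q powi (- n) - 1) * q powi (1 - n)) \<and>
       (\<forall>n\<ge>0. \<forall>x. x \<noteq> 0 \<longrightarrow>
          Dqinv q (poly (P n)) x
            = qinv_bracket q n * poly (P (n - 1)) x
              + q powi (n - 3) / (inverse q - 1) * \<alpha> n * \<alpha> (n - 1) * \<alpha> (n - 2)
                * poly (P (n - 3)) x))"
proof -
  have c: "0 < c"
    using assms by simp
  have P_nonneg: "degree (P n) = nat n" "lead_coeff (P n) = 1" if "0 \<le> n" for n
    using assms(5) that by (auto simp: monic_sequence_def)
  interpret F: quartic_orthogonal q
    "\<lambda>p. jackson_integral q (\<lambda>x. poly p (c * x) * weight q (c * x))" "\<lambda>n. P (int n)"
  proof (intro quartic_orthogonal.intro quartic_orthogonal_axioms.intro)
    show "quartic_functional q (\<lambda>p. jackson_integral q (\<lambda>x. poly p (c * x) * weight q (c * x)))"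
      using jackson_functional[OF assms(1,2) c] .
    show "degree (P (int n)) = n" "coeff (P (int n)) n = 1" for n
      using P_nonneg[of "int n"] by simp_all
    show "jackson_integral q (\<lambda>x. poly (P (int n) * P (int m)) (c * x) * weight q (c * x)) = 0"
      if "n \<noteq> m" for n m
      using assms(6) that unfolding orthogonal_sequence_def poly_mult
      by (metis of_nat_0_le_iff of_nat_eq_iff)
  qed
  define A where "A n = F.\<alpha> (nat n)" for n :: int
  have rec: "recurrence_coeffs P A"
    unfolding recurrence_coeffs_def
  proof (intro conjI allI impI)
    show "A n = 0" if "n \<le> 0" for n
      using that by (simp add: A_def F.alpha_0)
    show "[:0, 1:] * P n = P (n + 1) + smult (A n) (P (n - 1))" if "0 \<le> n" for n
    proof -
      obtain m where m: "n = int m"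
        using nonneg_int_cases[OF \<open>0 \<le> n\<close>] by metis
      have "smult (F.\<alpha> m) (P (int (m - 1))) = smult (F.\<alpha> m) (P (int m - 1))"
        by (cases m) (simp_all add: F.alpha_0)
      then show ?thesis
        using F.three_term_recurrence[of m] by (simp add: m A_def monom_altdef add.commute)
    qed
  qed
  have unique: "\<beta> = A" if \<beta>: "recurrence_coeffs P \<beta>" for \<beta>
  proof
    fix n :: int
    show "\<beta> n = A n"
    proof (cases "n \<le> 0")
      case True
      then show ?thesis
        using rec \<beta> by (simp add: recurrence_coeffs_def)
    next
      case False
      then have "smult (\<beta> n) (P (n - 1)) = smult (A n) (P (n - 1))"
        using rec \<beta> unfolding recurrence_coeffs_def by (metis add_left_cancel linorder_le_cases)
      then have "smult (\<beta> n - A n) (P (n - 1)) = 0"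
        by (simp add: smult_diff_left)
      moreover have "P (n - 1) \<noteq> 0"
        using P_nonneg(2)[of "n - 1"] False by auto
      ultimately show ?thesis by simp
    qed
  qed
  have nonlinear: "A n * (A (n + 1) + q powi (n - 1) * A n + q powi (- 2) * A (n - 1)
          - q powi (2 * n - 3) * A (n + 1) * A n * A (n - 1))
        = (q powi (- n) - 1) * q powi (1 - n)" if "1 \<le> n" for n
  proof -
    define m where "m = nat (n - 1)"
    have m: "n = int m + 1"
      using that by (simp add: m_def)
    have A: "A n = F.\<alpha> (m + 1)" "A (n + 1) = F.\<alpha> (m + 2)" "A (n - 1) = F.\<alpha> m"
      by (simp_all add: A_def m nat_add_distrib)
    have exponents: "2 * n - 3 = int (2 * m) - 1" "- n = - int (m + 1)" "1 - n = - int m" "n - 1 = int m"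
      by (simp_all add: m)
    have "q powi (int (2 * m) - 1) = q ^ (2 * m) / q"
      using assms(1) by (subst power_int_diff) (simp_all del: of_nat_mult)
    moreover have "q powi (- int k) = inverse q ^ k" for k
      by (simp add: power_int_minus power_inverse)
    moreover have "q powi (- 2) = inverse q ^ 2"
      by (simp add: power_int_minus power_inverse)
    ultimately have powers: "q powi (2 * n - 3) = q ^ (2 * m) / q" "q powi (- n) = inverse q ^ (m + 1)"
      "q powi (1 - n) = inverse q ^ m" "q powi (n - 1) = q ^ m" "q powi (- 2) = inverse q ^ 2"
      unfolding exponents by (simp_all only: power_int_of_nat)
    show ?thesis
      unfolding A powers using F.nonlinear_recurrence[of m] .
  qed
  have lowering: "Dqinv q (poly (P n)) x
        = qinv_bracket q n * poly (P (n - 1)) x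
          + q powi (n - 3) / (inverse q - 1) * A n * A (n - 1) * A (n - 2) * poly (P (n - 3)) x"
    if "0 \<le> n" "x \<noteq> 0" for n x
  proof -
    obtain m where m: "n = int m"
      using nonneg_int_cases[OF \<open>0 \<le> n\<close>] by metis
    have bracket: "qinv_bracket q n = (inverse q ^ m - 1) / (inverse q - 1)"
      by (simp add: qinv_bracket_def m power_int_minus power_inverse)
    have "Dqinv q (poly (P n)) x = poly (qdiff (inverse q) (P (int m))) x / (inverse q - 1)"
      using poly_qdiff[of x "inverse q" "P (int m)"] that(2)
      by (simp add: Dqinv_def m) (metis mult.assoc nonzero_mult_divide_mult_cancel_left)
    also have "\<dots> = (inverse q ^ m - 1) / (inverse q - 1) * poly (P (int (m - 1))) x
        + q ^ (m - 3) / (inverse q - 1) * F.\<alpha> m * F.\<alpha> (m - 1) * F.\<alpha> (m - 2) * poly (P (int (m - 3))) x"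
      unfolding F.lowering_relation by (simp add: add_divide_distrib)
    also have "(inverse q ^ m - 1) / (inverse q - 1) * poly (P (int (m - 1))) x
        = qinv_bracket q n * poly (P (n - 1)) x"
      unfolding bracket by (cases m) (simp_all add: m)
    also have "q ^ (m - 3) / (inverse q - 1) * F.\<alpha> m * F.\<alpha> (m - 1) * F.\<alpha> (m - 2) * poly (P (int (m - 3))) x
        = q powi (n - 3) / (inverse q - 1) * A n * A (n - 1) * A (n - 2) * poly (P (n - 3)) x"
    proof (cases "m < 3")
      case True
      then have "m - 2 = 0" by linarith
      then show ?thesis by (auto simp: A_def m F.alpha_0)
    next
      case False
      then have "n - 3 = int (m - 3)" "nat n = m" "nat (n - 1) = m - 1" "nat (n - 2) = m - 2"
        by (simp_all add: m)
      then show ?thesis by (simp only: A_def power_int_of_nat)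
    qed
    finally show ?thesis .
  qed
  show ?thesis
    using rec unique nonlinear lowering by blast
qed

end
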